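(* Let $c>0$ and $\alpha>2$ be constants, and for each sufficiently large $N$ let $p=p(a)=\dfrac{c}{N^{\alpha}}$. Let $|\mathcal{E}_N|$ be the number of edges of the random intersection graph $G_N$ of $N$ independent uniform spherical caps of angular radius $a$ (each of area $4\pi p$) on the unit sphere, and let $\lambda_N=\sum_{1\le i<j\le N}P[C_i\cap C_j\neq\emptyset]<\infty$. Then $$d_{TV}\big(|\mathcal{E}_N|,\mathrm{Po}(\lambda_N)\big)\to 0\qquad\text{as } N\to\infty,$$ i.e. the number of edges of $G_N$ is asymptotically, in total variation distance, a Poisson random variable with parameter $\lambda_N$.
   Context: Let $S^2$ be the unit sphere in $\mathbb{R}^3$, with total area $4\pi$. Let $X_1,X_2,\ldots$ be independent random points, each uniformly distributed on $S^2$. For a given $N$ and angular radius $a=a(N)$, let $C_i$ ($1\le i\le N$) be the (closed) spherical cap with center $X_i$ and angular radius $a$, i.e. the set of points of $S^2$ at geodesic distance at most $a$ from $X_i$. Let $p=p(a)=\sin^2(a/2)$ be the probability that a fixed point of the sphere is covered by a given cap; equivalently, each cap has area $4\pi p$. Prescribing $p\in(0,1]$ determines $a\in(0,\pi]$; for $p=c/N^{\alpha}$ only those (large) $N$ with $p\le 1$ are considered. The random intersection graph $G_N$ has vertex set $\mathcal{X}_N=\{X_1,\ldots,X_N\}$ and edge set $\mathcal{E}_N=\{X_iX_j: i\ne j,\ C_i\cap C_j\neq\emptyset\}$ (unordered pairs), and $|\mathcal{E}_N|$ is the number of edges. $\mathrm{Po}(\lambda)$ denotes a Poisson random variable with parameter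 $\lambda$, and for integer-valued random variables $d_{TV}(Y,Z)=\sup_{A\subseteq\mathbb{Z}}|P[Y\in A]-P[Z\in A]|$. *)

theory Defs
  imports "HOL-Probability.Probability"
begin

definition S2 :: "(real ^ 3) set"
  where "S2 = sphere 0 1"

(* Surface area on the sphere, in polar-coordinate form: the area of a Borel set A is 3 times the
   volume of the solid cone {r *R u | 0 < r <= 1, u in A} over it.  Here sgn x = x /R norm x is the
   radial projection, so the cone is the preimage of A in the punctured closed unit ball. *)
definition sphere_area :: "(real ^ 3) measure"
  where "sphere_area =
    scale_measure 3 (distr (restrict_space lborel (cball 0 1 - {0})) (restrict_space borel S2) sgn)"

definition uniform_S2 :: "(real ^ 3) measure"
  where "uniform_S2 = uniform_measure sphere_area S2"

lemma space_sphere_area [simp]: "space sphere_area = S2"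
  by (simp add: sphere_area_def space_scale_measure space_restrict_space)

lemma sets_sphere_area [simp, measurable_cong]: "sets sphere_area = sets (restrict_space borel S2)"
  by (simp add: sphere_area_def)

lemma space_uniform_S2 [simp]: "space uniform_S2 = S2"
  by (simp add: uniform_S2_def)

lemma sets_uniform_S2 [simp, measurable_cong]: "sets uniform_S2 = sets (restrict_space borel S2)"
  by (simp add: uniform_S2_def)

lemma sgn_measurable_S2:
  "sgn \<in> restrict_space lborel (cball 0 1 - {0}) \<rightarrow>\<^sub>M restrict_space borel S2"
proof (rule measurable_restrict_space2)
  have "(\<lambda>x::real^3. x /\<^sub>R norm x) \<in> borel_measurable borel"
    by measurable
  then have "(sgn :: real^3 \<Rightarrow> _) \<in> borel_measurable borel"
    by (simp add: sgn_div_norm[abs_def])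
  then show "(sgn :: real^3 \<Rightarrow> _) \<in> borel_measurable (restrict_space lborel (cball 0 1 - {0}))"
    by (intro measurable_restrict_space1) simp
qed (auto simp: S2_def space_restrict_space norm_sgn)

lemma emeasure_sphere_area:
  assumes "A \<in> sets (restrict_space borel S2)"
  shows "emeasure sphere_area A = 3 * emeasure lborel {x \<in> cball 0 1 - {0}. sgn x \<in> A}"
proof -
  have "emeasure sphere_area A =
      3 * emeasure (restrict_space lborel (cball 0 1 - {0})) {x \<in> cball 0 1 - {0}. sgn x \<in> A}"
    using assms by (simp add: sphere_area_def emeasure_scale_measure
        emeasure_distr[OF sgn_measurable_S2] space_restrict_space vimage_def Int_def conj_ac)
  also have "\<dots> = 3 * emeasure lborel {x \<in> cball 0 1 - {0}. sgn x \<in> A}"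
    by (subst emeasure_restrict_space) auto
  finally show ?thesis .
qed

lemma emeasure_sphere_area_S2: "emeasure sphere_area S2 = ennreal (4 * pi)"
proof -
  have "{x \<in> cball (0::real^3) 1 - {0}. sgn x \<in> S2} = cball 0 1 - {0}"
    by (auto simp: S2_def norm_sgn)
  moreover have "emeasure lborel (cball (0::real^3) 1 - {0}) = ennreal (4 / 3 * pi)"
    by (subst emeasure_Diff) (auto simp: emeasure_cball unit_ball_vol_3)
  moreover have "S2 \<in> sets (restrict_space borel S2)"
    by (metis sets.top space_sphere_area sets_sphere_area)
  moreover have "(3::ennreal) * ennreal (4 / 3 * pi) = ennreal (4 * pi)"
    by (simp flip: ennreal_numeral ennreal_mult)
  ultimately show ?thesis
    by (simp add: emeasure_sphere_area)
qed

lemma prob_space_uniform_S2: "prob_space uniform_S2"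
  unfolding uniform_S2_def
  by (rule prob_space_uniform_measure) (simp_all add: emeasure_sphere_area_S2)

(* Great-circle distance; meaningful for x and y on the unit sphere. *)
definition geodesic_dist :: "real ^ 3 \<Rightarrow> real ^ 3 \<Rightarrow> real"
  where "geodesic_dist x y = arccos (x \<bullet> y)"

definition cap :: "real ^ 3 \<Rightarrow> real \<Rightarrow> (real ^ 3) set"
  where "cap x a = {y \<in> S2. geodesic_dist x y \<le> a}"

(* The parameter p(a): the fraction of the sphere covered by a cap of angular radius a, whose
   area is 2 * pi * (1 - cos a) = 4 * pi * (sin (a / 2))^2. *)
definition cap_prob :: "real \<Rightarrow> real"
  where "cap_prob a = (sin (a / 2))\<^sup>2"

(* Vertices are the points themselves and edges are unordered pairs of points; two coinciding
   centres (an event of probability 0) would contribute the degenerate pair {x}. *)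
definition intersection_graph ::
    "nat \<Rightarrow> real \<Rightarrow> (nat \<Rightarrow> real ^ 3) \<Rightarrow> (real ^ 3) set \<times> (real ^ 3) set set"
  where "intersection_graph N a x =
    (x ` {1..N},
     {{x i, x j} | i j. i \<in> {1..N} \<and> j \<in> {1..N} \<and> i \<noteq> j \<and> cap (x i) a \<inter> cap (x j) a \<noteq> {}})"

definition edges :: "'v set \<times> 'v set set \<Rightarrow> 'v set set"
  where "edges G = snd G"

definition d_TV :: "'a measure \<Rightarrow> ('a \<Rightarrow> int) \<Rightarrow> 'b measure \<Rightarrow> ('b \<Rightarrow> int) \<Rightarrow> real"
  where "d_TV M Y M' Z =
    (SUP A. \<bar>measure M {\<omega> \<in> space M. Y \<omega> \<in> A} - measure M' {\<omega> \<in> space M'. Z \<omega> \<in> A}\<bar>)"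

end

theory Submission
  imports Defs
begin

text \<open>For \<open>\<alpha> > 2\<close> the expected number of edges tends to zero, so the edge count and the Poisson variable
  are asymptotically both concentrated at 0, and hence close to each other.

  Two caps of small angular radius \<open>a\<close> meet exactly when the chord between their centres has length at
  most \<open>r = 2 * sin a\<close> (\<open>caps_meet_iff\<close>). A disc of that size on the sphere has uniform probability
  at most of order \<open>r\<^sup>2\<close> (\<open>measure_uniform_S2_cball_le\<close>), hence by independence a pair of caps meets with
  probability at most of order \<open>r\<^sup>2\<close>, that is, of order \<open>cap_prob a\<close> (\<open>independent_uniform_close\<close>). Summing
  over the at most \<open>N\<^sup>2\<close> pairs, \<open>lam N\<close> is at most of order \<open>N powr (2 - \<alpha>)\<close> and vanishes in the limit.

  An integer-valued variable that is nonzero with probability at most \<open>\<epsilon>\<close> has distance at most \<open>\<epsilon>\<close>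
  from any other such variable (\<open>d_TV_le_prob_nonzero\<close>). For the edge count this applies with
  \<open>\<epsilon> = lam N\<close> by the union bound, and for the Poisson variable because \<open>1 - exp (- l) \<le> l\<close>. The
  distance is therefore at most \<open>lam N\<close> (\<open>edge_count_near_poisson\<close>).

  What needs care is measurability: the supremum in \<open>d_TV\<close> compares probabilities of events that must
  be measurable for the argument, which is why the meeting of two caps is characterised
  exactly and the cardinality of the edge set is shown to be a random variable
  (\<open>card_image_predicate_measurable\<close>), allowing for centres that coincide.\<close>

section \<open>When two caps meet\<close>

text \<open>A point common to both caps has inner product at least \<open>2 * cos a\<close> with \<open>x + y\<close>, and among all
  points of the sphere the midpoint \<open>sgn (x + y)\<close> maximises that inner product, with maximum
  \<open>norm (x + y)\<close>. The parallelogram law turns this condition on the sum into one on the chord.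
  The assumption \<open>0 < cos a\<close> guarantees \<open>x + y \<noteq> 0\<close> once the condition on the sum holds. For obtuse
  \<open>a\<close> the equivalence fails: any two caps meet, while \<open>2 * sin a\<close> is less than the diameter.\<close>

lemma caps_meet_iff:
  assumes x: "x \<in> S2" and y: "y \<in> S2" and a: "0 \<le> a" "a \<le> pi" and cos_pos: "0 < cos a"
  shows "cap x a \<inter> cap y a \<noteq> {} \<longleftrightarrow> dist x y \<le> 2 * sin a"
proof -
  have xx: "x \<bullet> x = 1" and yy: "y \<bullet> y = 1"
    using x y by (simp_all add: S2_def dot_square_norm)
  have mem_cap: "z \<in> cap u a \<longleftrightarrow> z \<in> S2 \<and> cos a \<le> u \<bullet> z" if "u \<in> S2" for u z
  proof (cases "z \<in> S2")
    case True
    with that have "\<bar>u \<bullet> z\<bar> \<le> 1"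
      using Cauchy_Schwarz_ineq2[of u z] by (simp add: S2_def)
    then have "arccos (u \<bullet> z) \<le> a \<longleftrightarrow> cos a \<le> u \<bullet> z"
      using arccos_le_mono[of "u \<bullet> z" "cos a"] a by (simp add: arccos_cos)
    then show ?thesis using True by (simp add: cap_def geodesic_dist_def)
  qed (simp add: cap_def)
  have parallelogram: "(norm (x + y))\<^sup>2 = 4 - (dist x y)\<^sup>2"
    by (simp add: dist_norm power2_norm_eq_inner algebra_simps inner_commute xx yy)
  have "cap x a \<inter> cap y a \<noteq> {} \<longleftrightarrow> 2 * cos a \<le> norm (x + y)"
  proof
    assume "cap x a \<inter> cap y a \<noteq> {}"
    then obtain z where z: "z \<in> S2" "cos a \<le> x \<bullet> z" "cos a \<le> y \<bullet> z"
      using mem_cap x y by blast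
    have "2 * cos a \<le> (x + y) \<bullet> z" using z by (simp add: inner_add_left)
    also have "\<dots> \<le> norm (x + y)"
      using norm_cauchy_schwarz[of "x + y" z] z(1) by (simp add: S2_def)
    finally show "2 * cos a \<le> norm (x + y)" .
  next
    assume far: "2 * cos a \<le> norm (x + y)"
    then have pos: "norm (x + y) > 0" using cos_pos by linarith
    have sq: "(norm (x + y))\<^sup>2 = 2 + 2 * (x \<bullet> y)"
      by (simp add: power2_norm_eq_inner algebra_simps inner_commute xx yy)
    define z where "z = sgn (x + y)"
    have z: "z \<in> S2" using pos by (auto simp: z_def S2_def norm_sgn)
    have "x \<bullet> z = norm (x + y) / 2" "y \<bullet> z = norm (x + y) / 2"
      using pos sq
      by (simp_all add: z_def sgn_div_norm inner_add_right xx yy inner_commute field_simps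
          power2_eq_square)
    then have "z \<in> cap x a \<inter> cap y a" using far z mem_cap x y by auto
    then show "cap x a \<inter> cap y a \<noteq> {}" by blast
  qed
  also have "\<dots> \<longleftrightarrow> (2 * cos a)\<^sup>2 \<le> (norm (x + y))\<^sup>2"
    using cos_pos abs_le_square_iff[of "2 * cos a" "norm (x + y)"] by simp
  also have "\<dots> \<longleftrightarrow> (dist x y)\<^sup>2 \<le> (2 * sin a)\<^sup>2"
    using sin_cos_squared_add[of a] unfolding parallelogram power_mult_distrib
    by (intro iffI; simp; linarith)
  also have "\<dots> \<longleftrightarrow> dist x y \<le> 2 * sin a"
    using sin_ge_zero[of a] a abs_le_square_iff[of "dist x y" "2 * sin a"] by simp
  finally show ?thesis .
qed

section \<open>The area of small discs on the sphere\<close>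

lemma cball_Int_S2_sets: "S2 \<inter> cball x r \<in> sets (restrict_space borel S2)"
  unfolding sets_restrict_space by auto

lemma measure_uniform_S2:
  assumes "A \<in> sets (restrict_space borel S2)"
  shows "measure uniform_S2 A = 3 / (4 * pi) * measure lborel {y \<in> cball 0 1 - {0}. sgn y \<in> A}"
proof -
  have A: "A \<in> sets sphere_area" and S2: "S2 \<in> sets sphere_area"
    using assms sets.top[of sphere_area] by simp_all
  have "S2 \<inter> A = A" using sets.sets_into_space[OF A] by auto
  then have "measure uniform_S2 A = measure sphere_area A / measure sphere_area S2"
    unfolding uniform_S2_def using A emeasure_sphere_area_S2 by simp
  then show ?thesis
    using emeasure_sphere_area[OF assms] emeasure_sphere_area_S2
    by (simp add: measure_def enn2real_mult)
qed

lemma sets_cone_over: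
  assumes "A \<in> sets (restrict_space borel S2)"
  shows "{y \<in> cball 0 1 - {0}. sgn y \<in> A} \<in> sets lborel"
proof -
  have "sgn -` A \<inter> space (restrict_space lborel (cball 0 1 - {0}))
      \<in> sets (restrict_space lborel (cball 0 1 - {0}))"
    using assms sgn_measurable_S2 by (rule measurable_sets[rotated])
  moreover have "sgn -` A \<inter> space (restrict_space lborel (cball 0 1 - {0}))
      = {y \<in> cball 0 1 - {0}. sgn y \<in> A}"
    by (auto simp: space_restrict_space)
  ultimately show ?thesis
    by (auto simp: sets_restrict_space_iff)
qed

text \<open>The cone over the spherical disc of radius \<open>r\<close> around \<open>x\<close> stays within \<open>r\<close> of the segment from \<open>0\<close>
  to \<open>x\<close>. The roughly \<open>1 / r\<close> grid points at spacing \<open>r\<close> on this segment therefore cover the cone by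
  balls of radius \<open>2 * r\<close>, each of volume proportional to \<open>r ^ 3\<close>, so the volume is of order \<open>r\<^sup>2\<close>.
  The covering treats all centres alike, at the price of the constant 24 in place of the exact 1/4.\<close>

lemma measure_uniform_S2_cball_le:
  assumes x: "x \<in> S2" and r: "0 < r" "r \<le> 1"
  shows "measure uniform_S2 (S2 \<inter> cball x r) \<le> 24 * r\<^sup>2"
proof -
  define n where "n = nat \<lceil>1 / r\<rceil>"
  have n: "real n + 1 \<le> 3 / r"
  proof -
    have "real n = of_int \<lceil>1 / r\<rceil>" using r by (simp add: n_def)
    then have "real n \<le> 1 / r + 1" by linarith
    moreover have "2 \<le> 2 / r" using r by (simp add: field_simps)
    ultimately show ?thesis by simp
  qed
  let ?K = "{y \<in> cball 0 1 - {0}. sgn y \<in> S2 \<inter> cball x r}"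
  have cover: "?K \<subseteq> (\<Union>m\<in>{..n}. cball ((real m * r) *\<^sub>R x) (2 * r))"
  proof
    fix y assume y: "y \<in> ?K"
    define t where "t = norm y"
    have t: "0 \<le> t" "t \<le> 1" and y_eq: "y = t *\<^sub>R sgn y"
      using y by (simp_all add: t_def sgn_div_norm)
    \<comment> \<open>The grid point closest to \<open>y\<close> from below in the radial direction.\<close>
    define m where "m = nat \<lfloor>t / r\<rfloor>"
    have m: "real m \<le> t / r" "t / r < real m + 1"
      using t r unfolding m_def by (simp_all add: floor_less_iff)
    have "real m * r \<le> t" "t \<le> real m * r + r" using m r by (simp_all add: field_simps)
    then have mr: "\<bar>real m * r - t\<bar> \<le> r" by simp
    have "t / r \<le> 1 / r" using t r by (simp add: divide_right_mono)
    then have "m \<le> n" using floor_mono[of "t / r" "1 / r"] unfolding m_def n_def by linarith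
    have "dist ((real m * r) *\<^sub>R x) y = norm ((real m * r - t) *\<^sub>R x + t *\<^sub>R (x - sgn y))"
      by (subst y_eq) (simp add: dist_norm algebra_simps)
    also have "\<dots> \<le> \<bar>real m * r - t\<bar> * norm x + t * norm (x - sgn y)"
      using norm_triangle_ineq[of "(real m * r - t) *\<^sub>R x" "t *\<^sub>R (x - sgn y)"] t by simp
    also have "\<dots> \<le> r + 1 * r"
    proof (rule add_mono)
      show "\<bar>real m * r - t\<bar> * norm x \<le> r" using mr x by (simp add: S2_def)
      show "t * norm (x - sgn y) \<le> 1 * r"
        using t y by (intro mult_mono) (auto simp: dist_norm)
    qed
    finally show "y \<in> (\<Union>m\<in>{..n}. cball ((real m * r) *\<^sub>R x) (2 * r))"
      using \<open>m \<le> n\<close> by auto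
  qed
  have "measure lborel ?K \<le> measure lborel (\<Union>m\<in>{..n}. cball ((real m * r) *\<^sub>R x) (2 * r))"
    by (rule measure_mono_fmeasurable[OF cover sets_cone_over[OF cball_Int_S2_sets]])
      (auto intro!: fmeasurable.finite_UN fmeasurableI emeasure_bounded_finite)
  also have "\<dots> \<le> (\<Sum>m\<le>n. measure lborel (cball ((real m * r) *\<^sub>R x) (2 * r)))"
    by (rule measure_UNION_le) auto
  also have "\<dots> = (real n + 1) * (4 / 3 * pi * (2 * r) ^ 3)"
    using r by (simp add: content_cball unit_ball_vol_3)
  also have "\<dots> \<le> 3 / r * (4 / 3 * pi * (2 * r) ^ 3)"
    using r n by (intro mult_right_mono) auto
  also have "\<dots> = 4 * pi / 3 * (24 * r\<^sup>2)"
    using r by (simp add: power3_eq_cube power2_eq_square)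
  finally have "3 / (4 * pi) * measure lborel ?K \<le> 3 / (4 * pi) * (4 * pi / 3 * (24 * r\<^sup>2))"
    by (intro mult_left_mono) auto
  then show ?thesis by (simp add: measure_uniform_S2 cball_Int_S2_sets)
qed

text \<open>Radial projection is continuous at \<open>x / 2\<close>, so the cone contains a ball around that point.\<close>

lemma measure_uniform_S2_cball_pos:
  assumes x: "x \<in> S2" and r: "0 < r"
  shows "0 < measure uniform_S2 (S2 \<inter> cball x r)"
proof -
  let ?K = "{y \<in> cball 0 1 - {0}. sgn y \<in> S2 \<inter> cball x r}"
  let ?h = "(1 / 2) *\<^sub>R x"
  have nx: "norm x = 1" using x by (simp add: S2_def)
  have "continuous (at ?h) (sgn :: real ^ 3 \<Rightarrow> _)"
    using nx by (auto simp: continuous_at intro!: tendsto_sgn)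
  moreover have "sgn ?h = x" using nx by (simp add: sgn_scaleR sgn_div_norm)
  ultimately obtain d where d: "d > 0" and sgn_near: "\<And>y. dist y ?h < d \<Longrightarrow> dist (sgn y) x < r"
    using r unfolding continuous_at_eps_delta by metis
  \<comment> \<open>A radius of at most 1/2 keeps the ball around \<open>x / 2\<close> inside the unit ball and away from 0.\<close>
  define e where "e = min d (1 / 2)"
  have e: "0 < e" "e \<le> d" "e \<le> 1 / 2" using d by (auto simp: e_def)
  have "ball ?h e \<subseteq> ?K"
  proof
    fix y assume "y \<in> ball ?h e"
    then have *: "dist y ?h < e" by (simp add: dist_commute)
    then have "norm (y - ?h) < 1 / 2" using e by (simp add: dist_norm)
    moreover have "norm ?h = 1 / 2" using nx by simp
    ultimately have "y \<noteq> 0" "norm y \<le> 1"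
      using norm_triangle_ineq[of "y - ?h" ?h] by (auto simp: norm_minus_commute)
    then show "y \<in> ?K"
      using sgn_near[of y] * e by (auto simp: S2_def norm_sgn dist_commute)
  qed
  have K: "?K \<in> sets lborel" by (rule sets_cone_over[OF cball_Int_S2_sets])
  have "0 < measure lborel (ball ?h e)" using e content_ball_pos[of e ?h] by simp
  also have "\<dots> \<le> measure lborel ?K"
  proof (rule measure_mono_fmeasurable[OF \<open>ball ?h e \<subseteq> ?K\<close>])
    show "?K \<in> fmeasurable lborel"
      by (rule fmeasurableI2[of "cball 0 1"]) (use K in \<open>auto intro!: fmeasurableI emeasure_bounded_finite\<close>)
  qed simp
  finally show ?thesis by (simp add: measure_uniform_S2 cball_Int_S2_sets)
qed

section \<open>Two independent uniform points being close\<close>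

lemma (in prob_space) emeasure_independent_pair:
  assumes indep: "indep_var S X T Y" and X: "distr M S X = D" and Y: "distr M T Y = E"
    and A: "A \<in> sets (S \<Otimes>\<^sub>M T)"
  shows "emeasure M {\<omega> \<in> space M. (X \<omega>, Y \<omega>) \<in> A} = (\<integral>\<^sup>+x. emeasure E (Pair x -` A) \<partial>D)"
proof -
  have [measurable]: "X \<in> M \<rightarrow>\<^sub>M S" "Y \<in> M \<rightarrow>\<^sub>M T"
    and joint: "D \<Otimes>\<^sub>M E = distr M (S \<Otimes>\<^sub>M T) (\<lambda>\<omega>. (X \<omega>, Y \<omega>))"
    using indep X Y unfolding indep_var_distribution_eq by auto
  interpret E: prob_space E using prob_space_distr[of Y T] Y by simp
  have "emeasure M {\<omega> \<in> space M. (X \<omega>, Y \<omega>) \<in> A} = emeasure (D \<Otimes>\<^sub>M E) A"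
    unfolding joint using A by (subst emeasure_distr) (auto simp: vimage_def Int_def conj_commute)
  then show ?thesis using A E.emeasure_pair_measure_alt[of A D] unfolding joint by simp
qed

text \<open>The upper bound makes edges rare. The strict positivity makes the expected number of edges a
  legitimate Poisson parameter, since \<open>pmf_poisson\<close> describes \<open>poisson_pmf\<close> at positive rates only.\<close>

lemma independent_uniform_close:
  assumes "prob_space M" and indep: "prob_space.indep_var M uniform_S2 X uniform_S2 Y"
    and X: "distr M uniform_S2 X = uniform_S2" and Y: "distr M uniform_S2 Y = uniform_S2"
    and r: "0 < r" "r \<le> 1"
  shows "measure M {\<omega> \<in> space M. dist (X \<omega>) (Y \<omega>) \<le> r} \<in> {0 <.. 24 * r\<^sup>2}"
proof -
  interpret prob_space M by fact
  interpret U: prob_space uniform_S2 by (rule prob_space_uniform_S2)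
  let ?A = "{z \<in> space (uniform_S2 \<Otimes>\<^sub>M uniform_S2). dist (fst z) (snd z) \<le> r}"
  have XY: "X \<in> M \<rightarrow>\<^sub>M uniform_S2" "Y \<in> M \<rightarrow>\<^sub>M uniform_S2"
    using indep unfolding indep_var_distribution_eq by auto
  have id: "(\<lambda>x. x) \<in> uniform_S2 \<rightarrow>\<^sub>M borel"
    using measurable_restrict_space1[of "\<lambda>x. x" borel borel S2]
    by (simp cong: measurable_cong_sets)
  have [measurable]: "fst \<in> uniform_S2 \<Otimes>\<^sub>M uniform_S2 \<rightarrow>\<^sub>M borel"
      "snd \<in> uniform_S2 \<Otimes>\<^sub>M uniform_S2 \<rightarrow>\<^sub>M borel"
    using measurable_compose[OF measurable_fst id] measurable_compose[OF measurable_snd id] by auto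
  have A: "?A \<in> sets (uniform_S2 \<Otimes>\<^sub>M uniform_S2)" by measurable
  have slice: "Pair x -` ?A = S2 \<inter> cball x r" if "x \<in> S2" for x
    using that by (auto simp: space_pair_measure)
  let ?E = "{\<omega> \<in> space M. dist (X \<omega>) (Y \<omega>) \<le> r}"
  have "?E = {\<omega> \<in> space M. (X \<omega>, Y \<omega>) \<in> ?A}"
    using measurable_space[OF XY(1)] measurable_space[OF XY(2)]
    by (auto simp: space_pair_measure)
  then have "emeasure M ?E = (\<integral>\<^sup>+x. emeasure uniform_S2 (Pair x -` ?A) \<partial>uniform_S2)"
    using emeasure_independent_pair[OF indep X Y A] by simp
  also have "\<dots> = (\<integral>\<^sup>+x. emeasure uniform_S2 (S2 \<inter> cball x r) \<partial>uniform_S2)"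
    by (rule nn_integral_cong) (simp add: slice del: vimage_Collect_eq)
  finally have E: "emeasure M ?E = (\<integral>\<^sup>+x. emeasure uniform_S2 (S2 \<inter> cball x r) \<partial>uniform_S2)" .
  have "emeasure M ?E \<le> (\<integral>\<^sup>+x. ennreal (24 * r\<^sup>2) \<partial>uniform_S2)"
    unfolding E using measure_uniform_S2_cball_le[OF _ r]
    by (intro nn_integral_mono) (simp add: U.emeasure_eq_measure ennreal_leI)
  then have "prob ?E \<le> 24 * r\<^sup>2"
    using U.emeasure_space_1 by (simp add: emeasure_eq_measure)
  moreover have "emeasure M ?E \<noteq> 0"
  proof
    assume "emeasure M ?E = 0"
    moreover have "(\<lambda>x. emeasure uniform_S2 (S2 \<inter> cball x r)) \<in> borel_measurable uniform_S2"
      using U.measurable_emeasure_Pair[OF A] slice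
      by (subst measurable_cong[where g="\<lambda>x. emeasure uniform_S2 (Pair x -` ?A)"])
        (simp_all del: vimage_Collect_eq)
    ultimately have "AE x in uniform_S2. emeasure uniform_S2 (S2 \<inter> cball x r) = 0"
      unfolding E by (simp add: nn_integral_0_iff_AE)
    moreover have "AE x in uniform_S2. emeasure uniform_S2 (S2 \<inter> cball x r) \<noteq> 0"
      using measure_uniform_S2_cball_pos[OF _ r(1)]
      by (intro AE_I2) (auto simp: U.emeasure_eq_measure less_le)
    ultimately have "AE x in uniform_S2. False" by eventually_elim simp
    then show False by simp
  qed
  ultimately show ?thesis by (auto simp: emeasure_eq_measure zero_less_measure_iff)
qed

section \<open>Measurability of a random cardinality\<close>

text \<open>The random set is a random selection from a finite family of random elements, in which different
  indices may give the same element. Adding an index raises the cardinality by one exactly when the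
  index is selected and its element is new, which is a Boolean combination of
  selection events and coincidence events.\<close>

lemma card_image_predicate_measurable:
  fixes f :: "'i \<Rightarrow> 'w \<Rightarrow> 'e" and H :: "'i \<Rightarrow> 'w \<Rightarrow> bool"
  assumes "finite J"
    and "\<And>p. p \<in> J \<Longrightarrow> Measurable.pred M (H p)"
    and "\<And>p q. p \<in> J \<Longrightarrow> q \<in> J \<Longrightarrow> Measurable.pred M (\<lambda>\<omega>. f p \<omega> = f q \<omega>)"
  shows "(\<lambda>\<omega>. card {f p \<omega> | p. p \<in> J \<and> H p \<omega>}) \<in> M \<rightarrow>\<^sub>M count_space UNIV"
  using assms
proof (induction J rule: finite_induct)
  case (insert p J)
  let ?E = "\<lambda>\<omega>. {f q \<omega> | q. q \<in> J \<and> H q \<omega>}"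
  let ?new = "\<lambda>\<omega>. H p \<omega> \<and> (\<forall>q\<in>J. H q \<omega> \<longrightarrow> f p \<omega> \<noteq> f q \<omega>)"
  have "card {f q \<omega> | q. q \<in> insert p J \<and> H q \<omega>} = card (?E \<omega>) + (if ?new \<omega> then 1 else 0)" for \<omega>
  proof -
    have "{f q \<omega> | q. q \<in> insert p J \<and> H q \<omega>} = (if H p \<omega> then insert (f p \<omega>) (?E \<omega>) else ?E \<omega>)"
      by auto
    moreover have "finite (?E \<omega>)" using insert.hyps by simp
    moreover have "?new \<omega> \<longleftrightarrow> H p \<omega> \<and> f p \<omega> \<notin> ?E \<omega>" by auto
    ultimately show ?thesis by (simp add: card_insert_if)
  qed
  moreover have [measurable]: "(\<lambda>\<omega>. card (?E \<omega>)) \<in> M \<rightarrow>\<^sub>M count_space UNIV"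
    using insert by simp
  moreover have [measurable]: "Measurable.pred M ?new"
  proof (intro pred_intros_logic pred_intros_finite)
  qed (use insert in auto)
  ultimately show ?case by simp
qed simp

section \<open>Total variation distance of two mostly vanishing variables\<close>

text \<open>If both variables vanish up to probability \<open>\<epsilon>\<close>, then for every set both probabilities lie in
  \<open>{1 - \<epsilon>..1}\<close> or in \<open>{0..\<epsilon>}\<close>, according to whether the set contains 0. The lower bound on the
  distance accompanies the upper one because a real supremum is meaningful only for a bounded family,
  and boundedness comes from the same estimate.\<close>

lemma d_TV_le_prob_nonzero:
  assumes M: "prob_space M" and M': "prob_space M'"
    and Y: "Y \<in> M \<rightarrow>\<^sub>M count_space UNIV" and Z: "Z \<in> M' \<rightarrow>\<^sub>M count_space UNIV"
    and Y0: "measure M {\<omega> \<in> space M. Y \<omega> \<noteq> 0} \<le> \<epsilon>"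
    and Z0: "measure M' {\<omega> \<in> space M'. Z \<omega> \<noteq> 0} \<le> \<epsilon>"
  shows "0 \<le> d_TV M Y M' Z \<and> d_TV M Y M' Z \<le> \<epsilon>"
proof -
  let ?d = "\<lambda>A. \<bar>measure M {\<omega> \<in> space M. Y \<omega> \<in> A} - measure M' {\<omega> \<in> space M'. Z \<omega> \<in> A}\<bar>"
  have le: "?d A \<le> \<epsilon>" for A
  proof -
    have range: "(if 0 \<in> A then 1 - \<epsilon> else 0) \<le> measure N {\<omega> \<in> space N. W \<omega> \<in> A}
        \<and> measure N {\<omega> \<in> space N. W \<omega> \<in> A} \<le> (if 0 \<in> A then 1 else \<epsilon>)"
      if N: "prob_space N" and W [measurable]: "W \<in> N \<rightarrow>\<^sub>M count_space UNIV"
        and W0: "measure N {\<omega> \<in> space N. W \<omega> \<noteq> 0} \<le> \<epsilon>" for N :: "'c measure" and W :: "'c \<Rightarrow> int"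
    proof -
      interpret N: prob_space N by (rule N)
      show ?thesis
      proof (cases "0 \<in> A")
        case True
        have "1 - \<epsilon> \<le> 1 - N.prob {\<omega> \<in> space N. W \<omega> \<noteq> 0}" using W0 by simp
        also have "\<dots> = N.prob {\<omega> \<in> space N. W \<omega> = 0}"
          by (subst N.prob_neg[symmetric]) simp_all
        also have "\<dots> \<le> N.prob {\<omega> \<in> space N. W \<omega> \<in> A}"
          using True by (intro N.finite_measure_mono) auto
        finally show ?thesis using True by simp
      next
        case False
        have "N.prob {\<omega> \<in> space N. W \<omega> \<in> A} \<le> N.prob {\<omega> \<in> space N. W \<omega> \<noteq> 0}"
          using False by (intro N.finite_measure_mono) auto
        then show ?thesis using False W0 by simp
      qed
    qed
    have "0 \<le> measure M {\<omega> \<in> space M. Y \<omega> \<in> A}" "0 \<le> measure M' {\<omega> \<in> space M'. Z \<omega> \<in> A}"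
      by simp_all
    then show ?thesis using range[OF M Y Y0] range[OF M' Z Z0]
      by (smt (verit))
  qed
  have "0 \<le> ?d {}" by simp
  also have "?d {} \<le> d_TV M Y M' Z"
    unfolding d_TV_def by (rule cSUP_upper) (auto intro!: bdd_aboveI2[where M=\<epsilon>] le)
  finally show ?thesis unfolding d_TV_def using le by (auto intro: cSUP_least)
qed

lemma poisson_pmf_prob_nonzero:
  assumes "0 < l"
  shows "measure (poisson_pmf l) {k. k \<noteq> 0} \<le> l"
proof -
  have "measure (poisson_pmf l) {k. k \<noteq> 0} = 1 - pmf (poisson_pmf l) 0"
    using measure_pmf.prob_compl[of "{0}" "poisson_pmf l"]
    by (simp add: measure_pmf_single Compl_eq_Diff_UNIV[symmetric] Collect_neg_eq del: neq0_conv)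
  then show ?thesis using assms exp_ge_add_one_self[of "- l"] by simp
qed

section \<open>The number of edges\<close>

text \<open>The union bound over pairs of centres shows that the edge count is nonzero with probability at
  most \<open>lam\<close>, which is also a bound for the Poisson variable. The factor 384 is 24, from the area
  estimate, times 16, from the squared chord length \<open>r\<^sup>2 = 4 * (sin a)\<^sup>2 \<le> 16 * cap_prob a\<close>.\<close>

lemma edge_count_near_poisson:
  fixes M :: "'w measure" and X :: "nat \<Rightarrow> 'w \<Rightarrow> real ^ 3" and N :: nat and a :: real
  defines "lam \<equiv> (\<Sum>(i, j) \<in> {(i, j). 1 \<le> i \<and> i < j \<and> j \<le> N}.
      measure M {\<omega> \<in> space M. cap (X i \<omega>) a \<inter> cap (X j \<omega>) a \<noteq> {}})"
  assumes M: "prob_space M"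
    and indep: "prob_space.indep_vars M (\<lambda>_. uniform_S2) X {1..}"
    and unif: "\<And>i. i \<ge> 1 \<Longrightarrow> distr M uniform_S2 (X i) = uniform_S2"
    and N: "2 \<le> N" and a: "0 < a" "a \<le> pi" and p: "cap_prob a \<le> 1 / 16"
  shows "0 \<le> d_TV M (\<lambda>\<omega>. int (card (edges (intersection_graph N a (\<lambda>i. X i \<omega>)))))
      (measure_pmf (poisson_pmf lam)) int" (is "0 \<le> ?d")
    and "d_TV M (\<lambda>\<omega>. int (card (edges (intersection_graph N a (\<lambda>i. X i \<omega>)))))
      (measure_pmf (poisson_pmf lam)) int \<le> lam"
    and "lam \<le> 384 * (real N)\<^sup>2 * cap_prob a"
proof -
  interpret prob_space M by (rule M)
  have cos_a: "cos a = 1 - 2 * cap_prob a"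
    using cos_double_sin[of "a / 2"] by (simp add: cap_prob_def)
  then have cos_pos: "0 < cos a" using p by simp
  have "a \<noteq> pi" using cos_pos by auto
  then have sin_pos: "0 < sin a" using a by (intro sin_gt_zero) auto
  \<comment> \<open>The caps meet exactly when their centres are at chord distance at most \<open>r\<close>.\<close>
  define r where "r = 2 * sin a"
  have "r\<^sup>2 = 4 - 4 * (1 - 2 * cap_prob a)\<^sup>2"
    using sin_cos_squared_add[of a] unfolding cos_a r_def by (simp add: power_mult_distrib)
  also have "\<dots> \<le> 16 * cap_prob a"
    by (simp add: power2_eq_square algebra_simps)
  finally have r2: "r\<^sup>2 \<le> 16 * cap_prob a" .
  have r: "0 < r" "r \<le> 1"
    using sin_pos r2 p by (auto simp: r_def intro: power2_le_imp_le[where y=1])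
  have X: "X i \<in> M \<rightarrow>\<^sub>M uniform_S2" if "1 \<le> i" for i
    using indep that by (auto simp: indep_vars_def)
  then have S2: "X i \<omega> \<in> S2" if "1 \<le> i" "\<omega> \<in> space M" for i \<omega>
    using measurable_space[of "X i" M uniform_S2 \<omega>] that by simp
  have Xb [measurable]: "X i \<in> M \<rightarrow>\<^sub>M borel" if "1 \<le> i" for i
    using X[OF that] by (simp add: measurable_restrict_space2_iff cong: measurable_cong_sets)
  define hit where "hit p \<omega> \<longleftrightarrow> cap (X (fst p) \<omega>) a \<inter> cap (X (snd p) \<omega>) a \<noteq> {}" for p \<omega>
  have hit_iff: "hit (i, j) \<omega> \<longleftrightarrow> dist (X i \<omega>) (X j \<omega>) \<le> r"
    if "1 \<le> i" "1 \<le> j" "\<omega> \<in> space M" for i j \<omega>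
    unfolding hit_def r_def using caps_meet_iff[of "X i \<omega>" "X j \<omega>" a] S2 that a cos_pos by simp
  have hit_meas: "Measurable.pred M (hit p)" if "1 \<le> fst p" "1 \<le> snd p" for p
  proof -
    note [measurable] = Xb[OF that(1)] Xb[OF that(2)]
    have "Measurable.pred M (\<lambda>\<omega>. dist (X (fst p) \<omega>) (X (snd p) \<omega>) \<le> r)" by measurable
    then show ?thesis
      using hit_iff[OF that] by (simp cong: measurable_cong)
  qed
  have hit_prob: "prob {\<omega> \<in> space M. hit (i, j) \<omega>} \<in> {0 <.. 384 * cap_prob a}"
    if "1 \<le> i" "i < j" for i j
  proof -
    have "indep_var uniform_S2 ((\<lambda>x. x i) \<circ> (\<lambda>\<omega>. restrict (\<lambda>k. X k \<omega>) {i}))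
        uniform_S2 ((\<lambda>x. x j) \<circ> (\<lambda>\<omega>. restrict (\<lambda>k. X k \<omega>) {j}))"
      using that by (intro indep_var_compose[OF indep_var_restrict[OF indep]]) auto
    then have "indep_var uniform_S2 (X i) uniform_S2 (X j)" by (simp add: comp_def)
    then have "prob {\<omega> \<in> space M. dist (X i \<omega>) (X j \<omega>) \<le> r} \<in> {0 <.. 24 * r\<^sup>2}"
      using that by (intro independent_uniform_close M unif r) auto
    moreover have "{\<omega> \<in> space M. hit (i, j) \<omega>} = {\<omega> \<in> space M. dist (X i \<omega>) (X j \<omega>) \<le> r}"
      using hit_iff that by auto
    ultimately show ?thesis using r2 by auto
  qed
  define I where "I = {(i, j). 1 \<le> i \<and> i < j \<and> j \<le> N}"
  have I_sub: "I \<subseteq> {1..N} \<times> {1..N}" by (auto simp: I_def)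
  then have fin: "finite I" by (rule finite_subset) simp
  have lam: "lam = (\<Sum>p\<in>I. prob {\<omega> \<in> space M. hit p \<omega>})"
    unfolding lam_def I_def hit_def by (intro sum.cong) auto
  have "(1, 2) \<in> I" using N by (simp add: I_def)
  then have lam_pos: "0 < lam"
    unfolding lam using fin hit_prob by (intro sum_pos2[of _ "(1, 2)"]) (auto simp: I_def)
  have "lam \<le> (\<Sum>p\<in>I. 384 * cap_prob a)"
    unfolding lam using hit_prob by (intro sum_mono) (auto simp: I_def)
  also have "\<dots> = real (card I) * (384 * cap_prob a)" by simp
  also have "\<dots> \<le> (real N)\<^sup>2 * (384 * cap_prob a)"
  proof (rule mult_right_mono)
    have "card I \<le> card ({1..N} \<times> {1..N})" using I_sub by (intro card_mono) auto
    then show "real (card I) \<le> (real N)\<^sup>2"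
      by (simp add: card_cartesian_product power2_eq_square flip: of_nat_mult)
  qed (simp add: cap_prob_def)
  finally show "lam \<le> 384 * (real N)\<^sup>2 * cap_prob a" by simp

  \<comment> \<open>The graph is built from ordered pairs, whereas \<open>lam\<close> sums over the increasing pairs \<open>I\<close>.\<close>
  define J where "J = {(i, j). i \<in> {1..N} \<and> j \<in> {1..N} \<and> i \<noteq> j}"
  define f where "f p \<omega> = {X (fst p) \<omega>, X (snd p) \<omega>}" for p \<omega>
  let ?Y = "\<lambda>\<omega>. int (card (edges (intersection_graph N a (\<lambda>i. X i \<omega>))))"
  have edges: "edges (intersection_graph N a (\<lambda>i. X i \<omega>)) = {f p \<omega> | p. p \<in> J \<and> hit p \<omega>}" for \<omega>
    by (auto simp: edges_def intersection_graph_def f_def J_def hit_def)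
  have "finite J" by (rule finite_subset[of _ "{1..N} \<times> {1..N}"]) (auto simp: J_def)
  moreover have "Measurable.pred M (\<lambda>\<omega>. f p \<omega> = f q \<omega>)" if "p \<in> J" "q \<in> J" for p q
  proof -
    have 1: "1 \<le> fst p" "1 \<le> snd p" "1 \<le> fst q" "1 \<le> snd q" using that by (auto simp: J_def)
    note [measurable] = 1[THEN Xb]
    show ?thesis unfolding f_def doubleton_eq_iff by measurable
  qed
  ultimately have "(\<lambda>\<omega>. card {f p \<omega> | p. p \<in> J \<and> hit p \<omega>}) \<in> M \<rightarrow>\<^sub>M count_space UNIV"
    by (intro card_image_predicate_measurable hit_meas) (auto simp: J_def)
  then have Y: "?Y \<in> M \<rightarrow>\<^sub>M count_space UNIV"
    unfolding edges by (rule measurable_compose) simp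
  have "prob {\<omega> \<in> space M. ?Y \<omega> \<noteq> 0} \<le> prob (\<Union>p\<in>I. {\<omega> \<in> space M. hit p \<omega>})"
  proof (rule finite_measure_mono)
    show "{\<omega> \<in> space M. ?Y \<omega> \<noteq> 0} \<subseteq> (\<Union>p\<in>I. {\<omega> \<in> space M. hit p \<omega>})"
    proof
      fix \<omega> assume \<omega>: "\<omega> \<in> {\<omega> \<in> space M. ?Y \<omega> \<noteq> 0}"
      then have "{f p \<omega> | p. p \<in> J \<and> hit p \<omega>} \<noteq> {}"
        unfolding edges by (metis (mono_tags, lifting) card.empty mem_Collect_eq of_nat_0)
      then obtain i j where ij: "(i, j) \<in> J" "hit (i, j) \<omega>" by auto
      then have "hit (j, i) \<omega>" by (auto simp: hit_def)
      moreover have "(i, j) \<in> I \<or> (j, i) \<in> I" using ij by (auto simp: I_def J_def)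
      ultimately show "\<omega> \<in> (\<Union>p\<in>I. {\<omega> \<in> space M. hit p \<omega>})" using ij \<omega> by blast
    qed
    show "(\<Union>p\<in>I. {\<omega> \<in> space M. hit p \<omega>}) \<in> events"
      using hit_meas fin by (intro sets.finite_UN) (auto simp: I_def pred_def)
  qed
  also have "\<dots> \<le> lam"
    unfolding lam using hit_meas fin
    by (intro finite_measure_subadditive_finite) (auto simp: I_def pred_def)
  finally have Y0: "prob {\<omega> \<in> space M. ?Y \<omega> \<noteq> 0} \<le> lam" .
  have "measure (poisson_pmf lam) {k \<in> space (poisson_pmf lam). int k \<noteq> 0} \<le> lam"
    using poisson_pmf_prob_nonzero[OF lam_pos] by simp
  from d_TV_le_prob_nonzero[OF M prob_space_measure_pmf Y _ Y0 this]
  show "0 \<le> ?d" "?d \<le> lam" by simp_all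
qed

theorem theorem3p1:
  fixes M :: "'w measure" and X :: "nat \<Rightarrow> 'w \<Rightarrow> real ^ 3"
    and c \<alpha> :: real and a :: "nat \<Rightarrow> real" and lam :: "nat \<Rightarrow> real"
  assumes "prob_space M"
    and "prob_space.indep_vars M (\<lambda>_. uniform_S2) X {1..}"
    and "\<And>i. i \<ge> 1 \<Longrightarrow> distr M uniform_S2 (X i) = uniform_S2"
    and "c > 0" and "\<alpha> > 2"
    and "\<forall>\<^sub>F N in sequentially. 0 < a N \<and> a N \<le> pi \<and> cap_prob (a N) = c / real N powr \<alpha>"
    and "\<And>N. lam N = (\<Sum>(i, j) \<in> {(i, j). 1 \<le> i \<and> i < j \<and> j \<le> N}.
           measure M {\<omega> \<in> space M. cap (X i \<omega>) (a N) \<inter> cap (X j \<omega>) (a N) \<noteq> {}})"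
  shows "(\<lambda>N. d_TV M (\<lambda>\<omega>. int (card (edges (intersection_graph N (a N) (\<lambda>i. X i \<omega>)))))
                   (measure_pmf (poisson_pmf (lam N))) int) \<longlonglongrightarrow> 0"
proof -
  let ?d = "\<lambda>N. d_TV M (\<lambda>\<omega>. int (card (edges (intersection_graph N (a N) (\<lambda>i. X i \<omega>)))))
      (measure_pmf (poisson_pmf (lam N))) int"
  have powr_tendsto: "(\<lambda>N. C * real N powr s) \<longlonglongrightarrow> 0" if "s < 0" for C s :: real
    using tendsto_mult_left[OF tendsto_neg_powr[OF that filterlim_real_sequentially], of C] by simp
  \<comment> \<open>For large \<open>N\<close> the caps are small enough to lie in an open hemisphere and have \<open>r \<le> 1\<close>.\<close>
  have "(\<lambda>N. c / real N powr \<alpha>) \<longlonglongrightarrow> 0"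
    using powr_tendsto[of "- \<alpha>" c] \<open>\<alpha> > 2\<close> by (simp add: powr_minus_divide)
  then have "\<forall>\<^sub>F N in sequentially. c / real N powr \<alpha> < 1 / 16"
    by (rule order_tendstoD) simp
  with assms(6) eventually_ge_at_top[of 2]
  have bounds: "\<forall>\<^sub>F N in sequentially. 0 \<le> ?d N \<and> ?d N \<le> (384 * c) * real N powr (2 - \<alpha>)"
  proof eventually_elim
    case (elim N)
    note bound = edge_count_near_poisson[OF assms(1-3) elim(2), of "a N", folded assms(7)]
    have "lam N \<le> 384 * (real N)\<^sup>2 * (c / real N powr \<alpha>)"
      using bound(3) elim by simp
    also have "\<dots> = (384 * c) * real N powr (2 - \<alpha>)"
      using elim(2) by (simp add: powr_diff)
    finally show ?case using bound(1,2) elim by (auto intro: order_trans)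
  qed
  have "(\<lambda>N. (384 * c) * real N powr (2 - \<alpha>)) \<longlonglongrightarrow> 0"
    using \<open>\<alpha> > 2\<close> by (intro powr_tendsto) simp
  from tendsto_sandwich[OF _ _ tendsto_const this, of ?d] bounds show ?thesis
    unfolding eventually_conj_iff by blast
qed

end
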